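(* For every integer $n\geq 2$ and every prime number $p$, $$\Delta(n,p)=(p-1)\sum_{\alpha=1}^{\lfloor \log_p(n)\rfloor}\Psi\left(\left\lfloor \frac{n}{p^{\alpha}}\right\rfloor\right),$$ where $\Delta(n,p)=\sum_{1\leq k\leq n,\; p\mid k}\phi(k)$ and $\Psi(m)=\sum_{k=1}^{m}\phi(k)$ for every positive integer $m$.
   Context: $\phi$ is Euler's totient function: for a positive integer $k$, $\phi(k)$ is the number of integers $x$ with $1\leq x\leq k$ and $\gcd(x,k)=1$. For a real number $x$, $\lfloor x\rfloor$ is the unique integer $m$ with $m\leq x<m+1$. $\log_p$ is the logarithm to base $p$. An empty sum equals $0$ (so that both sides are $0$ when $n<p$). *)

theory Defs
  imports Complex_Main "HOL-Number_Theory.Totient"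
begin

definition Psi :: "nat \<Rightarrow> nat"
  where "Psi m = (\<Sum>k = 1..m. totient k)"

definition Delta :: "nat \<Rightarrow> nat \<Rightarrow> nat"
  where "Delta n p = (\<Sum>k | 1 \<le> k \<and> k \<le> n \<and> p dvd k. totient k)"

end

theory Submission
  imports Defs
begin

text \<open>Since \<open>totient (p * j)\<close> is \<open>p * totient j\<close> or \<open>(p - 1) * totient j\<close> according to
  whether \<open>p\<close> divides \<open>j\<close>, summing over the multiples \<open>k = p * j\<close> up to \<open>n\<close> yields
  \<open>\<Delta>(n, p) = (p - 1) \<Psi>(\<lfloor>n / p\<rfloor>) + \<Delta>(\<lfloor>n / p\<rfloor>, p)\<close>. Iterating this recurrence reaches an
  argument below \<open>p\<close>, where \<open>\<Delta>\<close> vanishes, after \<open>\<lfloor>log\<^sub>p n\<rfloor>\<close> steps.\<close>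

lemma totient_prime_mult:
  fixes p j :: nat
  assumes "prime p"
  shows "totient (p * j) = (p - 1) * totient j + (if p dvd j then totient j else 0)"
proof (cases "p dvd j")
  case True
  have "totient p > 0" using prime_gt_0_nat[OF assms] by simp
  \<comment> \<open>As \<open>p dvd j\<close>, the gcd of \<open>p\<close> and \<open>j\<close> is
    \<open>p\<close>; the factor \<open>totient p\<close> then cancels because it is
    positive.\<close>
  moreover have "totient (p * j) * totient p = totient p * totient j * p"
    using totient_gcd[of p j] True by simp
  ultimately have "totient (p * j) = p * totient j" by simp
  also have "\<dots> = (p - 1) * totient j + totient j"
    using prime_gt_0_nat[OF assms] by (cases p) auto
  finally show ?thesis using True by simp
next
  case False
  then have "coprime p j" using assms by (simp add: prime_imp_coprime)
  then show ?thesis using False assms by (simp add: totient_mult_coprime totient_prime)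
qed

lemma Delta_rec:
  assumes "prime p"
  shows "Delta n p = (p - 1) * Psi (n div p) + Delta (n div p) p"
proof -
  have p0: "p > 0" using assms by (rule prime_gt_0_nat)
  have image: "{k. 1 \<le> k \<and> k \<le> n \<and> p dvd k} = (*) p ` {1..n div p}"
    using p0 by (auto simp: less_eq_div_iff_mult_less_eq mult.commute elim!: dvdE)
  have inj: "inj_on ((*) p) {1..n div p}" using p0 by (auto simp: inj_on_def)
  have "Delta n p = (\<Sum>j = 1..n div p. totient (p * j))"
    unfolding Delta_def image by (simp only: sum.reindex[OF inj] o_def)
  also have "\<dots> = (\<Sum>j = 1..n div p. (p - 1) * totient j)
      + (\<Sum>j = 1..n div p. if p dvd j then totient j else 0)"
    by (simp only: totient_prime_mult[OF assms] sum.distrib)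
  also have "(\<Sum>j = 1..n div p. if p dvd j then totient j else 0) = Delta (n div p) p"
    unfolding Delta_def
    by (simp add: sum.inter_filter[symmetric] conj_assoc)
  finally show ?thesis by (simp add: Psi_def sum_distrib_left)
qed

lemma Delta_iterate:
  assumes "prime p"
  shows "Delta n p = (p - 1) * (\<Sum>\<alpha> = 1..m. Psi (n div p ^ \<alpha>)) + Delta (n div p ^ m) p"
proof (induction m)
  case (Suc m)
  \<comment> \<open>Nested integer divisions collapse, so each use of the recurrence raises the
    exponent by one.\<close>
  have "n div p ^ m div p = n div p ^ Suc m"
    by (simp only: div_mult2_eq[symmetric] power_Suc2)
  then show ?case
    using Suc Delta_rec[OF assms, of "n div p ^ m"] by (simp add: algebra_simps)
qed simp

lemma Delta_eq_0:
  assumes "n < p"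
  shows "Delta n p = 0"
proof -
  have "{k. 1 \<le> k \<and> k \<le> n \<and> p dvd k} = {}"
    using assms by (auto dest: dvd_imp_le)
  then show ?thesis by (simp add: Delta_def)
qed

lemma less_power_Suc_floor_log:
  fixes n p :: nat
  assumes "n > 0" and "p > 1"
  shows "n < p ^ Suc (nat \<lfloor>log p n\<rfloor>)"
proof -
  \<comment> \<open>True of any real in place of the logarithm: \<open>nat\<close> can only raise a
    negative floor.\<close>
  have "log p n < real (Suc (nat \<lfloor>log p n\<rfloor>))" by linarith
  then have "real n < real p powr real (Suc (nat \<lfloor>log p n\<rfloor>))"
    using assms by (subst (asm) log_less_iff) auto
  also have "\<dots> = real (p ^ Suc (nat \<lfloor>log p n\<rfloor>))"
    using assms by (subst powr_realpow) auto
  finally show ?thesis by (simp only: of_nat_less_iff)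
qed

theorem theorem5:
  fixes n p :: nat
  assumes "n \<ge> 2" and "prime p"
  shows "Delta n p =
    (p - 1) * (\<Sum>\<alpha> = 1..nat \<lfloor>log (real p) (real n)\<rfloor>. Psi (nat \<lfloor>real n / real p ^ \<alpha>\<rfloor>))"
proof -
  define m where "m = nat \<lfloor>log (real p) (real n)\<rfloor>"
  have "n < p ^ Suc m"
    unfolding m_def using assms prime_gt_1_nat by (intro less_power_Suc_floor_log) auto
  \<comment> \<open>After \<open>m\<close> steps the argument is below \<open>p\<close>, so the
    leftover \<open>Delta\<close> term vanishes.\<close>
  then have "n div p ^ m < p" by (simp add: less_mult_imp_div_less)
  then have "Delta n p = (p - 1) * (\<Sum>\<alpha> = 1..m. Psi (n div p ^ \<alpha>))"
    using Delta_iterate[OF assms(2), of n m] by (simp add: Delta_eq_0)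
  \<comment> \<open>The floor of the real quotient is natural-number division, the form used in the
    iteration.\<close>
  moreover have "nat \<lfloor>real n / real p ^ \<alpha>\<rfloor> = n div p ^ \<alpha>" for \<alpha>
    using floor_divide_of_nat_eq[of n "p ^ \<alpha>", where ?'a = real] by simp
  ultimately show ?thesis by (simp add: m_def)
qed

end
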